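(* Let $\alpha: I\subset\mathbb{R}\to E^3$ be a plane curve with principal normal $V_2$ and (constant) binormal $B$, a vector perpendicular to the plane of $\alpha$, and let $\theta$ be a constant. Then the ruled surface $$\phi: U\subset E^2\to E^3,\qquad \phi(u,v)=\alpha(u)+v\bigl(\sin(\theta)\,V_2(u)+\cos(\theta)\,B\bigr),$$ is a helix surface with the direction $B$ in $E^3$.
   Context: $E^3$ is $\mathbb{R}^3$ with the standard scalar product $\langle\cdot,\cdot\rangle$. The curve $\alpha$ is regular with nowhere vanishing curvature $k_1$, so that its Frenet frame $T=V_1$ (unit tangent), $V_2$ (principal normal), $B=V_3$ (binormal) is defined; since $\alpha$ is planar, its torsion is zero and $B$ is constant. The domain $U$ is an open set of pairs $(u,v)$, $u\in I$, on which $\phi$ is regular, i.e. $\phi_u$ and $\phi_v$ are linearly independent. Helix surface: a surface in $E^3$ is a helix with respect to a fixed unit vector $d$ if the angle between $d$ and the tangent plane is the same at all of its points; equivalently, $\langle d,Z\rangle$ is constant for a (suitably oriented) unit normal vector field $Z$ of the surface. *)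

theory Defs
  imports "HOL-Analysis.Analysis" "HOL-Analysis.Cross3"
begin

primrec Ck_on :: "nat \<Rightarrow> (real \<Rightarrow> 'a::real_normed_vector) \<Rightarrow> real set \<Rightarrow> bool" where
  "Ck_on 0 f S \<longleftrightarrow> continuous_on S f"
| "Ck_on (Suc k) f S \<longleftrightarrow>
     (\<forall>t\<in>S. f differentiable (at t)) \<and> Ck_on k (\<lambda>t. vector_derivative f (at t)) S"

text \<open>The Frenet apparatus is that of a regular curve in an arbitrary parametrization, so the
  curvature is the derivative of the unit tangent divided by the speed.\<close>

definition unit_tangent :: "(real \<Rightarrow> real^3) \<Rightarrow> real \<Rightarrow> real^3" where
  "unit_tangent \<alpha> u =
     vector_derivative \<alpha> (at u) /\<^sub>R norm (vector_derivative \<alpha> (at u))"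

definition curvature :: "(real \<Rightarrow> real^3) \<Rightarrow> real \<Rightarrow> real" where
  "curvature \<alpha> u =
     norm (vector_derivative (unit_tangent \<alpha>) (at u)) / norm (vector_derivative \<alpha> (at u))"

definition principal_normal :: "(real \<Rightarrow> real^3) \<Rightarrow> real \<Rightarrow> real^3" where
  "principal_normal \<alpha> u =
     vector_derivative (unit_tangent \<alpha>) (at u) /\<^sub>R
       norm (vector_derivative (unit_tangent \<alpha>) (at u))"

definition binormal :: "(real \<Rightarrow> real^3) \<Rightarrow> real \<Rightarrow> real^3" where
  "binormal \<alpha> u = cross3 (unit_tangent \<alpha> u) (principal_normal \<alpha> u)"

definition frenet_curve_on :: "(real \<Rightarrow> real^3) \<Rightarrow> real set \<Rightarrow> bool" where
  "frenet_curve_on \<alpha> I \<longleftrightarrow>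
     Ck_on 3 \<alpha> I \<and>
     (\<forall>u\<in>I. vector_derivative \<alpha> (at u) \<noteq> 0) \<and>
     (\<forall>u\<in>I. curvature \<alpha> u \<noteq> 0)"

definition partial_u :: "(real \<times> real \<Rightarrow> real^3) \<Rightarrow> real \<times> real \<Rightarrow> real^3" where
  "partial_u \<phi> p = vector_derivative (\<lambda>t. \<phi> (t, snd p)) (at (fst p))"

definition partial_v :: "(real \<times> real \<Rightarrow> real^3) \<Rightarrow> real \<times> real \<Rightarrow> real^3" where
  "partial_v \<phi> p = vector_derivative (\<lambda>t. \<phi> (fst p, t)) (at (snd p))"

text \<open>The inequality is needed because \<open>independent\<close> speaks about the set of the two vectors,
  which is a singleton if they coincide.\<close>

definition regular_at :: "(real \<times> real \<Rightarrow> real^3) \<Rightarrow> real \<times> real \<Rightarrow> bool" where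
  "regular_at \<phi> p \<longleftrightarrow>
     partial_u \<phi> p \<noteq> partial_v \<phi> p \<and> independent {partial_u \<phi> p, partial_v \<phi> p}"

definition regular_surface :: "(real \<times> real \<Rightarrow> real^3) \<Rightarrow> (real \<times> real) set \<Rightarrow> bool" where
  "regular_surface \<phi> U \<longleftrightarrow>
     open U \<and>
     (\<forall>p\<in>U. \<phi> differentiable (at p)) \<and>
     continuous_on U (partial_u \<phi>) \<and> continuous_on U (partial_v \<phi>) \<and>
     (\<forall>p\<in>U. regular_at \<phi> p)"

definition tangent_plane :: "(real \<times> real \<Rightarrow> real^3) \<Rightarrow> real \<times> real \<Rightarrow> (real^3) set" where
  "tangent_plane \<phi> p = span {partial_u \<phi> p, partial_v \<phi> p}"

text \<open>The angle in \<open>[0, pi/2]\<close> between a nonzero vector and a nonzero subspace, as the least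
  angle between the vector and the nonzero vectors of the subspace. Unlike the angle with the
  orthogonal projection, it needs no separate case for a vector orthogonal to the subspace.\<close>

definition subspace_angle :: "'a::euclidean_space \<Rightarrow> 'a set \<Rightarrow> real" where
  "subspace_angle d V = (INF w\<in>V - {0}. arccos (inner d w / (norm d * norm w)))"

definition helix_surface ::
    "real^3 \<Rightarrow> (real \<times> real \<Rightarrow> real^3) \<Rightarrow> (real \<times> real) set \<Rightarrow> bool" where
  "helix_surface d \<phi> U \<longleftrightarrow>
     norm d = 1 \<and> regular_surface \<phi> U \<and>
     (\<exists>\<psi>. \<forall>p\<in>U. subspace_angle d (tangent_plane \<phi> p) = \<psi>)"

definition normal_ruled_surface ::
    "(real \<Rightarrow> real^3) \<Rightarrow> real^3 \<Rightarrow> real \<Rightarrow> real \<times> real \<Rightarrow> real^3" where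
  "normal_ruled_surface \<alpha> B \<theta> =
     (\<lambda>(u, v). \<alpha> u + v *\<^sub>R (sin \<theta> *\<^sub>R principal_normal \<alpha> u + cos \<theta> *\<^sub>R B))"

end

theory Submission
  imports Defs
begin

text \<open>The plane of the curve has a unit normal \<open>n\<close>, which is orthogonal to \<open>T\<close> and \<open>V\<^sub>2\<close>; so
  \<open>B = \<plusminus>n\<close>, with a constant sign by continuity. Put \<open>w = sin \<theta> V\<^sub>2 + cos \<theta> B = \<phi>\<^sub>v\<close>. Since \<open>\<alpha>'\<close> and
  \<open>V\<^sub>2'\<close> are orthogonal to both \<open>V\<^sub>2\<close> and \<open>B\<close>, the vector \<open>\<phi>\<^sub>u = \<alpha>' + v sin \<theta> V\<^sub>2'\<close> is orthogonal to
  \<open>w\<close> and to \<open>B\<close>. Hence \<open>\<plusminus>w\<close> is the direction of the tangent plane closest to \<open>B\<close>, and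
  the angle is \<open>arccos \<bar>cos \<theta>\<bar>\<close> at every point.\<close>

section \<open>Functions of class \<open>C\<^sup>k\<close>\<close>

text \<open>The two-sided derivative at \<open>t\<close> sees a whole neighbourhood of
  \<open>t\<close>. Openness of \<open>S\<close> puts that neighbourhood inside \<open>S\<close>, so
  agreement on \<open>S\<close> passes to the derivatives and on down the recursion.\<close>

lemma Ck_on_cong:
  assumes "open S" "\<And>t. t \<in> S \<Longrightarrow> f t = g t"
  shows "Ck_on k f S \<longleftrightarrow> Ck_on k g S"
  using assms(2)
proof (induction k arbitrary: f g)
  case 0
  then show ?case by (simp cong: continuous_on_cong)
next
  case (Suc k)
  have ev: "eventually (\<lambda>x. f x = g x) (nhds t)" if "t \<in> S" for t
    using assms(1) that Suc.prems eventually_nhds by blast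
  have "f differentiable (at t) \<longleftrightarrow> g differentiable (at t)" if "t \<in> S" for t
    using has_derivative_transform_within_open[OF _ assms(1) that]
    unfolding differentiable_def by (metis Suc.prems)
  moreover have "vector_derivative f (at t) = vector_derivative g (at t)" if "t \<in> S" for t
    using ev[OF that] that by (intro vector_derivative_cong_eq) (auto elim: eventually_mono)
  ultimately show ?case
    using Suc.IH[of "\<lambda>t. vector_derivative f (at t)" "\<lambda>t. vector_derivative g (at t)"]
    by simp
qed

text \<open>Lets an induction continue with an explicit formula \<open>f'\<close> for the
  derivative, produced by the calculus rules, in place of the opaque
  \<open>vector_derivative\<close>.\<close>

lemma Ck_on_SucI:
  assumes "open S" "\<And>t. t \<in> S \<Longrightarrow> (f has_vector_derivative f' t) (at t)" "Ck_on k f' S"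
  shows "Ck_on (Suc k) f S"
proof -
  have "vector_derivative f (at t) = f' t" if "t \<in> S" for t
    using assms(2)[OF that] by (rule vector_derivative_at)
  then have "Ck_on k (\<lambda>t. vector_derivative f (at t)) S"
    using Ck_on_cong[OF assms(1), of "\<lambda>t. vector_derivative f (at t)" f'] assms(3) by blast
  then show ?thesis
    using assms(2) by (auto intro: differentiableI_vector)
qed

lemma Ck_on_has_vector_derivative:
  assumes "Ck_on (Suc k) f S" "t \<in> S"
  shows "(f has_vector_derivative vector_derivative f (at t)) (at t)"
  using assms by (simp add: vector_derivative_works)

lemma Ck_on_Suc_imp_Ck_on: "Ck_on (Suc k) f S \<Longrightarrow> Ck_on k f S"
proof (induction k arbitrary: f)
  case 0
  then show ?case
    by (simp add: continuous_at_imp_continuous_on differentiable_imp_continuous_within)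
next
  case (Suc k)
  then show ?case by (metis Ck_on.simps(2))
qed

lemma Ck_on_imp_continuous_on: "Ck_on k f S \<Longrightarrow> continuous_on S f"
  by (induction k) (use Ck_on_Suc_imp_Ck_on in \<open>auto simp del: Ck_on.simps(2)\<close>)

lemma Ck_on_add:
  assumes "open S" "Ck_on k f S" "Ck_on k g S"
  shows "Ck_on k (\<lambda>t. f t + g t) S"
  using assms(2,3)
proof (induction k arbitrary: f g)
  case 0
  then show ?case by (auto intro: continuous_intros)
next
  case (Suc k)
  show ?case
  proof (rule Ck_on_SucI[OF assms(1)])
    show "((\<lambda>t. f t + g t) has_vector_derivative
        vector_derivative f (at t) + vector_derivative g (at t)) (at t)" if "t \<in> S" for t
      by (intro has_vector_derivative_add Ck_on_has_vector_derivative[OF Suc.prems(1) that]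
          Ck_on_has_vector_derivative[OF Suc.prems(2) that])
    show "Ck_on k (\<lambda>t. vector_derivative f (at t) + vector_derivative g (at t)) S"
      using Suc by simp
  qed
qed

lemma Ck_on_bounded_linear:
  assumes "bounded_linear h" "open S" "Ck_on k f S"
  shows "Ck_on k (\<lambda>t. h (f t)) S"
  using assms(3)
proof (induction k arbitrary: f)
  case 0
  then show ?case using assms(1) by (auto intro: bounded_linear.continuous_on)
next
  case (Suc k)
  show ?case
  proof (rule Ck_on_SucI[OF assms(2)])
    show "((\<lambda>t. h (f t)) has_vector_derivative h (vector_derivative f (at t))) (at t)"
      if "t \<in> S" for t
      by (intro bounded_linear.has_vector_derivative[OF assms(1)]
          Ck_on_has_vector_derivative[OF Suc.prems that])
    show "Ck_on k (\<lambda>t. h (vector_derivative f (at t))) S"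
      using Suc by simp
  qed
qed

text \<open>The product rule leaves products that pair one function with the derivative of the
  other; all factors are of class \<open>k\<close>, so the induction closes. Inner product,
  multiplication and scaling are all instances.\<close>

lemma Ck_on_bounded_bilinear:
  assumes "bounded_bilinear h" "open S" "Ck_on k f S" "Ck_on k g S"
  shows "Ck_on k (\<lambda>t. h (f t) (g t)) S"
  using assms(3,4)
proof (induction k arbitrary: f g)
  case 0
  then show ?case using assms(1) by (auto intro: bounded_bilinear.continuous_on)
next
  case (Suc k)
  show ?case
  proof (rule Ck_on_SucI[OF assms(2)])
    show "((\<lambda>t. h (f t) (g t)) has_vector_derivative
        h (f t) (vector_derivative g (at t)) + h (vector_derivative f (at t)) (g t)) (at t)"
      if "t \<in> S" for t
      by (intro bounded_bilinear.has_vector_derivative[OF assms(1)]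
          Ck_on_has_vector_derivative[OF Suc.prems(1) that]
          Ck_on_has_vector_derivative[OF Suc.prems(2) that])
    show "Ck_on k (\<lambda>t. h (f t) (vector_derivative g (at t)) +
        h (vector_derivative f (at t)) (g t)) S"
      using Suc.IH Suc.prems Ck_on_Suc_imp_Ck_on[OF Suc.prems(1)]
        Ck_on_Suc_imp_Ck_on[OF Suc.prems(2)] by (intro Ck_on_add[OF assms(2)]) auto
  qed
qed

text \<open>The derivative of \<open>r = inverse (norm f)\<close> is a polynomial in
  \<open>r\<close> and \<open>f \<bullet> f'\<close>, so the induction hypothesis for
  \<open>r\<close> itself supplies the next level.\<close>

lemma Ck_on_inverse_norm:
  fixes f :: "real \<Rightarrow> 'a::real_inner"
  assumes "open S" "Ck_on k f S" "\<And>t. t \<in> S \<Longrightarrow> f t \<noteq> 0"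
  shows "Ck_on k (\<lambda>t. inverse (norm (f t))) S"
  using assms(2)
proof (induction k)
  case 0
  then show ?case using assms(3) by (auto intro!: continuous_intros)
next
  case (Suc k)
  let ?f' = "\<lambda>t. vector_derivative f (at t)" and ?r = "\<lambda>t. inverse (norm (f t))"
  show ?case
  proof (rule Ck_on_SucI[OF assms(1)])
    \<comment> \<open>One factor \<open>?r\<close> comes from \<open>sgn (f t)\<close> in the
      derivative of the norm, the other two from differentiating the inverse.\<close>
    show "(?r has_vector_derivative - ((f t \<bullet> ?f' t) * (?r t * (?r t * ?r t)))) (at t)"
      if t: "t \<in> S" for t
    proof -
      have f': "(f has_derivative (\<lambda>x. x *\<^sub>R ?f' t)) (at t)"
        using Ck_on_has_vector_derivative[OF Suc.prems t]
        by (simp add: has_vector_derivative_def)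
      have "((\<lambda>t. norm (f t)) has_derivative (\<lambda>x. (x *\<^sub>R ?f' t) \<bullet> sgn (f t))) (at t)"
        using has_derivative_compose[OF f' has_derivative_norm[OF assms(3)[OF t]]] .
      from Deriv.has_derivative_inverse[OF _ this] show ?thesis
        using assms(3)[OF t] unfolding has_vector_derivative_def
        by (simp add: sgn_div_norm inner_commute mult_ac)
    qed
    have r: "Ck_on k ?r S"
      using Suc Ck_on_Suc_imp_Ck_on by blast
    have "Ck_on k (\<lambda>t. f t \<bullet> ?f' t) S"
      using Suc.prems Ck_on_Suc_imp_Ck_on[OF Suc.prems]
      by (intro Ck_on_bounded_bilinear[OF bounded_bilinear_inner assms(1)]) auto
    then show "Ck_on k (\<lambda>t. - ((f t \<bullet> ?f' t) * (?r t * (?r t * ?r t)))) S"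
      using r by (intro Ck_on_bounded_linear[OF bounded_linear_minus[OF bounded_linear_ident] assms(1)]
          Ck_on_bounded_bilinear[OF bounded_bilinear_mult assms(1)])
  qed
qed

lemma Ck_on_normalize:
  fixes f :: "real \<Rightarrow> 'a::real_inner"
  assumes "open S" "Ck_on k f S" "\<And>t. t \<in> S \<Longrightarrow> f t \<noteq> 0"
  shows "Ck_on k (\<lambda>t. f t /\<^sub>R norm (f t)) S"
  using assms by (intro Ck_on_bounded_bilinear[OF bounded_bilinear_scaleR] Ck_on_inverse_norm)

section \<open>Orthogonality\<close>

lemma derivative_orthogonal_if_inner_const:
  assumes "open S" "t \<in> S" "(f has_vector_derivative f') (at t)" "\<And>s. s \<in> S \<Longrightarrow> n \<bullet> f s = c"
  shows "n \<bullet> f' = 0"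
proof -
  have "((\<lambda>s. n \<bullet> f s) has_vector_derivative n \<bullet> f') (at t)"
    by (rule bounded_linear.has_vector_derivative[OF bounded_linear_inner_right assms(3)])
  moreover have "((\<lambda>s. n \<bullet> f s) has_vector_derivative 0) (at t)"
    by (rule has_vector_derivative_transform_within_open[OF has_vector_derivative_const[of c]])
      (use assms in auto)
  ultimately show ?thesis
    by (rule vector_derivative_unique_at)
qed

text \<open>Differentiating \<open>f s \<bullet> f s\<close>, which is constantly
  \<open>c\<^sup>2\<close> near \<open>t\<close>, gives twice the inner product in question.\<close>

lemma derivative_orthogonal_if_norm_const:
  fixes f :: "real \<Rightarrow> 'a::real_inner"
  assumes "open S" "t \<in> S" "(f has_vector_derivative f') (at t)" "\<And>s. s \<in> S \<Longrightarrow> norm (f s) = c"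
  shows "f t \<bullet> f' = 0"
proof -
  have "((\<lambda>s. f s \<bullet> f s) has_vector_derivative f t \<bullet> f' + f' \<bullet> f t) (at t)"
    by (rule bounded_bilinear.has_vector_derivative[OF bounded_bilinear_inner assms(3,3)])
  moreover have "((\<lambda>s. f s \<bullet> f s) has_vector_derivative 0) (at t)"
    by (rule has_vector_derivative_transform_within_open[OF has_vector_derivative_const[of "c\<^sup>2"]])
      (use assms in \<open>auto simp: dot_square_norm\<close>)
  ultimately have "f t \<bullet> f' + f' \<bullet> f t = 0"
    by (rule vector_derivative_unique_at)
  then show ?thesis by (simp add: inner_commute)
qed

text \<open>For \<open>x = a p + b w\<close> orthogonality leaves
  \<open>d \<bullet> x = b (d \<bullet> w)\<close> and \<open>\<bar>b\<bar> \<le> norm x\<close>.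
  Thus no cosine exceeds \<open>\<bar>d \<bullet> w\<bar>\<close>, and \<open>w\<close> or
  \<open>- w\<close> attains this value.\<close>

lemma subspace_angle_span_orthogonal:
  assumes "p \<bullet> w = 0" "p \<bullet> d = 0" "norm w = 1" "norm d = 1"
  shows "subspace_angle d (span {p, w}) = arccos \<bar>d \<bullet> w\<bar>"
  unfolding subspace_angle_def
proof (rule cInf_eq_minimum)
  have dw: "\<bar>d \<bullet> w\<bar> \<le> 1"
    using Cauchy_Schwarz_ineq2[of d w] assms by simp
  \<comment> \<open>This sign orients \<open>w\<close> towards \<open>d\<close>, which makes the
    cosine nonnegative.\<close>
  define s :: real where "s = (if d \<bullet> w \<ge> 0 then 1 else -1)"
  have "s *\<^sub>R w \<in> span {p, w}" "w \<noteq> 0"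
    using assms(3) by (auto intro: span_mul span_base)
  then have "s *\<^sub>R w \<in> span {p, w} - {0}"
    by (auto simp: s_def)
  moreover have "arccos \<bar>d \<bullet> w\<bar> = arccos (d \<bullet> (s *\<^sub>R w) / (norm d * norm (s *\<^sub>R w)))"
    using assms by (auto simp: s_def)
  ultimately show "arccos \<bar>d \<bullet> w\<bar> \<in> (\<lambda>x. arccos (d \<bullet> x / (norm d * norm x))) ` (span {p, w} - {0})"
    by blast
  fix y assume "y \<in> (\<lambda>x. arccos (d \<bullet> x / (norm d * norm x))) ` (span {p, w} - {0})"
  then obtain x where x: "x \<in> span {p, w}" "x \<noteq> 0" and y: "y = arccos (d \<bullet> x / norm x)"
    using assms(4) by auto
  obtain a b where ab: "x = a *\<^sub>R p + b *\<^sub>R w"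
    using x(1) by (auto simp: span_insert span_singleton) (metis add.commute diff_add_cancel)
  \<comment> \<open>The coefficient of the unit vector \<open>w\<close> is an inner product, hence
    bounded through Cauchy-Schwarz.\<close>
  have "w \<bullet> x = b"
    using assms by (simp add: ab inner_add_right inner_commute[of w p] dot_square_norm)
  then have "\<bar>b\<bar> \<le> norm x"
    using Cauchy_Schwarz_ineq2[of w x] assms(3) by simp
  moreover have "d \<bullet> x = b * (d \<bullet> w)"
    using assms by (simp add: ab inner_add_right inner_commute[of d p])
  ultimately have "\<bar>d \<bullet> x\<bar> \<le> norm x * \<bar>d \<bullet> w\<bar>"
    by (simp add: abs_mult mult_right_mono)
  then have "d \<bullet> x / norm x \<le> \<bar>d \<bullet> w\<bar>"
    using x(2) by (simp add: divide_simps mult.commute)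
  \<comment> \<open>\<open>arccos\<close> is decreasing only on [-1, 1], so the comparison needs
    this lower bound as well.\<close>
  moreover have "-1 \<le> d \<bullet> x / norm x"
    using Cauchy_Schwarz_ineq2[of d x] assms(4) x(2) by (simp add: field_simps abs_le_iff)
  ultimately show "arccos \<bar>d \<bullet> w\<bar> \<le> y"
    unfolding y using dw by (intro arccos_le_arccos) auto
qed

section \<open>Frenet frame and ruled surface\<close>

lemma frenet_curve_derivative:
  assumes "frenet_curve_on \<alpha> I" "u \<in> I"
  shows "(\<alpha> has_vector_derivative vector_derivative \<alpha> (at u)) (at u)"
  using assms Ck_on_has_vector_derivative[of 2 \<alpha> I u]
  by (simp add: frenet_curve_on_def eval_nat_numeral)

lemma frenet_curve_Ck_derivative:
  assumes "frenet_curve_on \<alpha> I"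
  shows "Ck_on 2 (\<lambda>u. vector_derivative \<alpha> (at u)) I"
  using assms by (simp add: frenet_curve_on_def eval_nat_numeral)

lemma frenet_curve_Ck_unit_tangent:
  assumes "open I" "frenet_curve_on \<alpha> I"
  shows "Ck_on 2 (unit_tangent \<alpha>) I"
  using Ck_on_normalize[OF assms(1) frenet_curve_Ck_derivative[OF assms(2)]] assms(2)
  by (simp add: frenet_curve_on_def unit_tangent_def[abs_def])

lemma frenet_curve_unit_tangent_derivative:
  assumes "open I" "frenet_curve_on \<alpha> I" "u \<in> I"
  shows "(unit_tangent \<alpha> has_vector_derivative vector_derivative (unit_tangent \<alpha>) (at u)) (at u)"
  using frenet_curve_Ck_unit_tangent[OF assms(1,2)] assms(3)
    Ck_on_has_vector_derivative[of 1 "unit_tangent \<alpha>" I u]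
  by (simp add: eval_nat_numeral)

text \<open>The norm of this derivative is the numerator of the curvature, so its vanishing would
  make the curvature 0.\<close>

lemma frenet_curve_unit_tangent_derivative_nonzero:
  assumes "frenet_curve_on \<alpha> I" "u \<in> I"
  shows "vector_derivative (unit_tangent \<alpha>) (at u) \<noteq> 0"
  using assms by (auto simp: frenet_curve_on_def curvature_def)

text \<open>A curve of class 3 has a unit tangent of class 2, whose derivative is of class 1 and
  stays so when normalized. This is just enough for the derivative of the normal, which occurs in
  \<open>partial_u\<close>, to be continuous.\<close>

lemma frenet_curve_Ck_principal_normal:
  assumes "open I" "frenet_curve_on \<alpha> I"
  shows "Ck_on 1 (principal_normal \<alpha>) I"
proof -
  have "Ck_on 1 (\<lambda>u. vector_derivative (unit_tangent \<alpha>) (at u)) I"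
    using frenet_curve_Ck_unit_tangent[OF assms] by (simp add: eval_nat_numeral)
  from Ck_on_normalize[OF assms(1) this] show ?thesis
    using frenet_curve_unit_tangent_derivative_nonzero[OF assms(2)]
    by (simp add: principal_normal_def[abs_def])
qed

lemma norm_unit_tangent:
  assumes "frenet_curve_on \<alpha> I" "u \<in> I"
  shows "norm (unit_tangent \<alpha> u) = 1"
  using assms by (simp add: frenet_curve_on_def unit_tangent_def)

lemma norm_principal_normal:
  assumes "frenet_curve_on \<alpha> I" "u \<in> I"
  shows "norm (principal_normal \<alpha> u) = 1"
  using frenet_curve_unit_tangent_derivative_nonzero[OF assms] by (simp add: principal_normal_def)

text \<open>The tangent has constant length, so it is orthogonal to its derivative, of which the
  principal normal is a multiple.\<close>

lemma unit_tangent_orthogonal_principal_normal: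
  assumes "open I" "frenet_curve_on \<alpha> I" "u \<in> I"
  shows "unit_tangent \<alpha> u \<bullet> principal_normal \<alpha> u = 0"
  using derivative_orthogonal_if_norm_const[OF assms(1,3)
      frenet_curve_unit_tangent_derivative[OF assms] norm_unit_tangent[OF assms(2)]]
  by (simp add: principal_normal_def)

lemma norm_binormal:
  assumes "open I" "frenet_curve_on \<alpha> I" "u \<in> I"
  shows "norm (binormal \<alpha> u) = 1"
  \<comment> \<open>The squared norm of a cross product is the product of the squared norms minus
    the squared inner product, here 1.\<close>
  using norm_cross[of "unit_tangent \<alpha> u" "principal_normal \<alpha> u"]
    unit_tangent_orthogonal_principal_normal[OF assms]
    norm_unit_tangent[OF assms(2,3)] norm_principal_normal[OF assms(2,3)]
  by (simp add: binormal_def power2_eq_1_iff) (smt (verit) norm_ge_zero)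

lemma derivative_eq_unit_tangent:
  assumes "frenet_curve_on \<alpha> I" "u \<in> I"
  shows "vector_derivative \<alpha> (at u) = norm (vector_derivative \<alpha> (at u)) *\<^sub>R unit_tangent \<alpha> u"
  using assms by (simp add: frenet_curve_on_def unit_tangent_def)

section \<open>Frenet frame of a plane curve\<close>

lemma planar_frenet_orthogonal:
  assumes "open I" "frenet_curve_on \<alpha> I" "\<And>u. u \<in> I \<Longrightarrow> n \<bullet> \<alpha> u = c" "u \<in> I"
  shows "n \<bullet> unit_tangent \<alpha> u = 0" "n \<bullet> principal_normal \<alpha> u = 0"
proof -
  \<comment> \<open>Differentiating \<open>n \<bullet> \<alpha> u = c\<close> gives this on all of
    \<open>I\<close>, as needed to differentiate once more and reach the principal normal.\<close>
  have T: "n \<bullet> unit_tangent \<alpha> u = 0" if "u \<in> I" for u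
    using derivative_orthogonal_if_inner_const[OF assms(1) that
        frenet_curve_derivative[OF assms(2) that] assms(3)]
    by (simp add: unit_tangent_def)
  show "n \<bullet> unit_tangent \<alpha> u = 0" using T[OF assms(4)] .
  show "n \<bullet> principal_normal \<alpha> u = 0"
    using derivative_orthogonal_if_inner_const[OF assms(1,4)
        frenet_curve_unit_tangent_derivative[OF assms(1,2,4)] T]
    by (simp add: principal_normal_def)
qed

text \<open>At each point the binormal is \<open>n\<close> or \<open>- n\<close>; a continuous
  choice of sign on an interval cannot jump.\<close>

lemma planar_binormal_constant:
  assumes "open I" "is_interval I" "frenet_curve_on \<alpha> I" "\<And>u. u \<in> I \<Longrightarrow> n \<bullet> \<alpha> u = c" "norm n = 1"
  obtains s where "\<And>u. u \<in> I \<Longrightarrow> binormal \<alpha> u = s *\<^sub>R n"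
proof -
  let ?g = "\<lambda>u. n \<bullet> binormal \<alpha> u"
  have B: "binormal \<alpha> u = ?g u *\<^sub>R n" if "u \<in> I" for u
  proof -
    \<comment> \<open>The double product is evaluated twice by the Lagrange identity. Expanding
      \<open>cross3 n (binormal \<alpha> u)\<close> in the frame gives 0, while expanding the outer
      product gives \<open>?g u *\<^sub>R n - binormal \<alpha> u\<close>.\<close>
    have "cross3 n (cross3 n (binormal \<alpha> u)) = 0"
      using planar_frenet_orthogonal[OF assms(1,3,4) that]
      by (simp add: binormal_def Lagrange)
    then show ?thesis
      using assms(5) by (simp add: Lagrange dot_square_norm)
  qed
  have "continuous_on I (unit_tangent \<alpha>)" "continuous_on I (principal_normal \<alpha>)"
    using frenet_curve_Ck_unit_tangent[OF assms(1,3)] frenet_curve_Ck_principal_normal[OF assms(1,3)]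
      Ck_on_imp_continuous_on by blast+
  then have "continuous_on I ?g"
    unfolding binormal_def by (intro continuous_intros continuous_on_cross)
  \<comment> \<open>Both sides of \<open>B\<close> are compared in norm, and both \<open>n\<close>
    and the binormal are unit vectors.\<close>
  moreover have "?g u \<in> {-1, 1}" if "u \<in> I" for u
    using arg_cong[OF B[OF that], of norm] norm_binormal[OF assms(1,3) that] assms(5) by auto
  then have "finite (?g ` I)"
    by (intro finite_subset[of "?g ` I" "{-1, 1}"]) auto
  ultimately have "?g constant_on I"
    using assms(2) by (intro continuous_finite_range_constant) (auto simp: is_interval_connected)
  then show thesis
    using B that unfolding constant_on_def by metis
qed

section \<open>The ruled surface: regularity and angle\<close>

lemma normal_ruled_surface_regular:
  assumes "open I" "frenet_curve_on \<alpha> I" "open U" "U \<subseteq> I \<times> UNIV"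
    and "\<And>p. p \<in> U \<Longrightarrow> regular_at (normal_ruled_surface \<alpha> B \<theta>) p"
  shows "regular_surface (normal_ruled_surface \<alpha> B \<theta>) U"
    and "(u, v) \<in> U \<Longrightarrow> partial_u (normal_ruled_surface \<alpha> B \<theta>) (u, v) =
      vector_derivative \<alpha> (at u) + (v * sin \<theta>) *\<^sub>R vector_derivative (principal_normal \<alpha>) (at u)"
    and "partial_v (normal_ruled_surface \<alpha> B \<theta>) (u, v) =
      sin \<theta> *\<^sub>R principal_normal \<alpha> u + cos \<theta> *\<^sub>R B"
proof -
  let ?\<phi> = "normal_ruled_surface \<alpha> B \<theta>"
  let ?N = "principal_normal \<alpha>" and ?\<alpha>' = "\<lambda>u. vector_derivative \<alpha> (at u)"
  let ?N' = "\<lambda>u. vector_derivative ?N (at u)"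
  \<comment> \<open>With projections instead of a case on pairs, the surface is built from
    one-variable functions composed with \<open>fst\<close>, to which the differentiation and
    continuity rules apply.\<close>
  have \<phi>: "?\<phi> = (\<lambda>p. \<alpha> (fst p) + snd p *\<^sub>R (sin \<theta> *\<^sub>R ?N (fst p) + cos \<theta> *\<^sub>R B))"
    by (auto simp: normal_ruled_surface_def)
  have I: "fst p \<in> I" if "p \<in> U" for p using that assms(4) by auto
  note \<alpha>' = frenet_curve_derivative[OF assms(2)]
  note C1 = frenet_curve_Ck_principal_normal[OF assms(1,2)]
  have N': "(?N has_vector_derivative ?N' u) (at u)" if "u \<in> I" for u
    using Ck_on_has_vector_derivative[of 0 ?N I u] C1 that by simp
  have pu: "partial_u ?\<phi> p = ?\<alpha>' (fst p) + (snd p * sin \<theta>) *\<^sub>R ?N' (fst p)" if "p \<in> U" for p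
    unfolding partial_u_def \<phi>
    by (rule vector_derivative_at) (auto intro!: derivative_eq_intros \<alpha>' N' I that)
  show "partial_u ?\<phi> (u, v) = ?\<alpha>' u + (v * sin \<theta>) *\<^sub>R ?N' u" if "(u, v) \<in> U"
    using pu[OF that] by simp
  have pv: "partial_v ?\<phi> p = sin \<theta> *\<^sub>R ?N (fst p) + cos \<theta> *\<^sub>R B" for p
    unfolding partial_v_def \<phi>
    by (rule vector_derivative_at) (auto intro!: derivative_eq_intros)
  show "partial_v ?\<phi> (u, v) = sin \<theta> *\<^sub>R ?N u + cos \<theta> *\<^sub>R B"
    using pv[of "(u, v)"] by simp
  have diff: "?\<phi> differentiable (at p)" if "p \<in> U" for p
  proof -
    \<comment> \<open>The chain rule lifts differentiability in the curve parameter to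
      differentiability in both variables.\<close>
    have fst: "(\<lambda>p::real \<times> real. f (fst p)) differentiable (at p)"
      if "(f has_vector_derivative f') (at (fst p))" for f :: "real \<Rightarrow> real^3" and f'
      using has_derivative_compose[OF has_derivative_fst[OF has_derivative_ident]
          that[unfolded has_vector_derivative_def]]
      unfolding differentiable_def by blast
    have "snd differentiable (at p)"
      by (simp add: bounded_linear_imp_differentiable bounded_linear_snd)
    then show ?thesis
      unfolding \<phi>
      by (intro differentiable_add differentiable_scaleR differentiable_const
          fst[OF \<alpha>'[OF I[OF that]]] fst[OF N'[OF I[OF that]]])
  qed
  have comp: "continuous_on U (\<lambda>p. f (fst p))" if "continuous_on I f" for f :: "real \<Rightarrow> real^3"
    using that I by (auto intro!: continuous_on_compose2[of I f] continuous_intros)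
  have "continuous_on I ?N'" using C1 by simp
  moreover have "continuous_on I ?\<alpha>'"
    using frenet_curve_Ck_derivative[OF assms(2)] Ck_on_imp_continuous_on by blast
  ultimately have "continuous_on U (\<lambda>p. ?\<alpha>' (fst p) + (snd p * sin \<theta>) *\<^sub>R ?N' (fst p))"
    by (intro continuous_intros comp)
  then have "continuous_on U (partial_u ?\<phi>)"
    using pu by (simp cong: continuous_on_cong)
  moreover have "continuous_on U (partial_v ?\<phi>)"
    unfolding pv using Ck_on_imp_continuous_on[OF C1]
    by (intro continuous_intros comp)
  ultimately show "regular_surface ?\<phi> U"
    using assms(3,5) diff by (simp add: regular_surface_def)
qed

text \<open>Formulated for a unit vector along which the curve has constant height, the form in
  which the plane of the curve enters; the binormal is substituted for \<open>B\<close> in the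
  end.\<close>

lemma normal_ruled_surface_helix:
  assumes I: "open I" "frenet_curve_on \<alpha> I" "open U" "U \<subseteq> I \<times> UNIV"
    and "\<And>p. p \<in> U \<Longrightarrow> regular_at (normal_ruled_surface \<alpha> B \<theta>) p"
    and B: "norm B = 1" "\<And>u. u \<in> I \<Longrightarrow> B \<bullet> \<alpha> u = c"
  shows "helix_surface B (normal_ruled_surface \<alpha> B \<theta>) U"
proof -
  note surf = normal_ruled_surface_regular[OF assms(1-5)]
  have "subspace_angle B (tangent_plane (normal_ruled_surface \<alpha> B \<theta>) p) = arccos \<bar>cos \<theta>\<bar>"
    if pU: "p \<in> U" for p
  proof -
    obtain u v where p: "p = (u, v)" by force
    then have u: "u \<in> I" using pU assms(4) by auto
    let ?N = "principal_normal \<alpha>"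
    let ?\<alpha>' = "vector_derivative \<alpha> (at u)" and ?N' = "vector_derivative ?N (at u)"
    \<comment> \<open>\<open>?w\<close> is the partial derivative in \<open>v\<close> and
      \<open>?x\<close> the one in \<open>u\<close>; they take the roles of \<open>w\<close> and
      \<open>p\<close> in \<open>subspace_angle_span_orthogonal\<close>.\<close>
    let ?w = "sin \<theta> *\<^sub>R ?N u + cos \<theta> *\<^sub>R B" and ?x = "?\<alpha>' + (v * sin \<theta>) *\<^sub>R ?N'"
    have orth: "B \<bullet> unit_tangent \<alpha> u = 0" "B \<bullet> ?N u = 0" if "u \<in> I" for u
      using planar_frenet_orthogonal[OF I(1,2) _ that] B(2) by blast+
    have N': "(?N has_vector_derivative ?N') (at u)"
      using Ck_on_has_vector_derivative[of 0 ?N I u] u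
        frenet_curve_Ck_principal_normal[OF I(1,2)] by simp
    have "B \<bullet> ?N' = 0"
      using derivative_orthogonal_if_inner_const[OF I(1) u N' orth(2)] .
    moreover have "?N u \<bullet> ?N' = 0"
      using derivative_orthogonal_if_norm_const[OF I(1) u N' norm_principal_normal[OF I(2)]] .
    moreover have "?\<alpha>' \<bullet> B = 0" "?\<alpha>' \<bullet> ?N u = 0"
      using orth(1)[OF u] unit_tangent_orthogonal_principal_normal[OF I(1,2) u]
      by (subst derivative_eq_unit_tangent[OF I(2) u], simp add: inner_commute)+
    ultimately have x: "?x \<bullet> ?w = 0" "?x \<bullet> B = 0"
      by (simp_all add: inner_add_left inner_add_right inner_commute)
    have NB: "?N u \<bullet> B = 0"
      using orth(2)[OF u] by (simp add: inner_commute)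
    \<comment> \<open>By Pythagoras this is the sum of the squares of \<open>sin \<theta>\<close>
      and \<open>cos \<theta>\<close>.\<close>
    have "(norm ?w)\<^sup>2 = 1"
      using NB B(1) norm_principal_normal[OF I(2) u]
      by (subst norm_add_Pythagorean) (auto simp: orthogonal_def)
    then have "norm ?w = 1"
      using norm_ge_zero[of ?w] by (simp only: power2_eq_1_iff) linarith
    moreover have "B \<bullet> ?w = cos \<theta>"
      using orth(2)[OF u] B(1) by (simp add: inner_add_right dot_square_norm)
    ultimately show ?thesis
      using subspace_angle_span_orthogonal[OF x _ B(1)] surf(2)[of u v] surf(3)[of u v] pU
      by (simp add: tangent_plane_def p)
  qed
  then show ?thesis
    using surf(1) B(1) by (auto simp: helix_surface_def)
qed

theorem theorem5p1:
  fixes \<alpha> :: "real \<Rightarrow> real^3" and I :: "real set" and P :: "(real^3) set" and \<theta> :: real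
  assumes "open I" "is_interval I" "I \<noteq> {}"
    and "frenet_curve_on \<alpha> I"
    and "affine P" "aff_dim P = 2" "\<alpha> ` I \<subseteq> P"
  shows "\<exists>B. (\<forall>u\<in>I. binormal \<alpha> u = B) \<and>
             (\<forall>x\<in>P. \<forall>y\<in>P. inner B (x - y) = 0) \<and>
             (\<forall>U. open U \<longrightarrow> U \<subseteq> I \<times> UNIV \<longrightarrow>
                  (\<forall>p\<in>U. regular_at (normal_ruled_surface \<alpha> B \<theta>) p) \<longrightarrow>
                  helix_surface B (normal_ruled_surface \<alpha> B \<theta>) U)"
proof -
  \<comment> \<open>Dimension 2 is less than 3, so \<open>P\<close> lies in a hyperplane; its
    equation is then normalized to have a unit normal.\<close>
  obtain a b where a: "a \<noteq> 0" "P \<subseteq> {x. a \<bullet> x = b}"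
    using aff_lowdim_subset_hyperplane[of P] assms(6) by auto
  let ?n = "a /\<^sub>R norm a" and ?c = "b / norm a"
  have P: "?n \<bullet> x = ?c" if "x \<in> P" for x
    using a that by (auto simp: divide_simps)
  then have n: "?n \<bullet> \<alpha> u = ?c" if "u \<in> I" for u
    using that assms(7) by blast
  have n1: "norm ?n = 1" using a(1) by simp
  obtain s where s: "\<And>u. u \<in> I \<Longrightarrow> binormal \<alpha> u = s *\<^sub>R ?n"
    using planar_binormal_constant[OF assms(1,2,4) n n1] by blast
  define B where "B = s *\<^sub>R ?n"
  \<comment> \<open>All points of \<open>P\<close> have the same height along \<open>B\<close>. This
    yields the orthogonality of \<open>B\<close> to \<open>P\<close> and also the constant height of
    the curve.\<close>
  have PB: "B \<bullet> x = s * ?c" if "x \<in> P" for x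
    using P[OF that] by (simp only: B_def inner_scaleR_left)
  \<comment> \<open>Since \<open>I\<close> is nonempty, \<open>B\<close> is the binormal at some
    point and inherits its unit length.\<close>
  have "norm B = 1"
    using assms(3) s norm_binormal[OF assms(1,4)] unfolding B_def by force
  then have "helix_surface B (normal_ruled_surface \<alpha> B \<theta>) U"
    if "open U" "U \<subseteq> I \<times> UNIV" "\<forall>p\<in>U. regular_at (normal_ruled_surface \<alpha> B \<theta>) p" for U
    using normal_ruled_surface_helix[OF assms(1,4) that(1,2)] that(3) PB assms(7) by blast
  moreover have "binormal \<alpha> u = B" if "u \<in> I" for u
    using s[OF that] by (simp only: B_def)
  ultimately show ?thesis
    using PB by (intro exI[of _ B]) (auto simp: inner_diff_right)
qed

end
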